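(* Let $X$ be a Banach space, $Y$ a Hilbert space, $A:X\to Y$ a bounded linear operator, and $\mathcal R:X\to(-\infty,\infty]$ a proper, lower semi-continuous, strongly convex function with modulus of convexity $\sigma>0$. Let $y\in Y$ be such that $Ax=y$ has a solution in $\mathrm{dom}(\mathcal R)$, and let $x^\dagger$ be the unique solution of $\min\{\mathcal R(x): x\in X,\ Ax=y\}$. Let $L:=\|A\|^2/(2\sigma)$. For $\delta>0$ and $y^\delta\in Y$ with $\|y^\delta-y\|\le\delta$, let $(x_n,\lambda_n)_{n\ge0}$ be generated by the dual gradient method with $\lambda_0=0$: $$x_n=\arg\min_{x\in X}\{\mathcal R(x)-\langle\lambda_n,Ax-y^\delta\rangle\},\qquad \lambda_{n+1}=\lambda_n-\gamma(Ax_n-y^\delta).$$ Assume that $\tau>1$ and $\gamma>0$ are chosen such that $1-1/\tau^2-L\gamma>0$, and let $n_\delta$ be the integer determined by the discrepancy principle $$\|Ax_{n_\delta}-y^\delta\|\le\tau\delta<\|Ax_n-y^\delta\|,\qquad 0\le n<n_\delta.$$ If there are a function $\mathcal E^\dagger:\mathrm{dom}(\mathcal R)\to[0,\infty)$ with $\mathcal E^\dagger(x^\dagger)=0$ and constants $0<q\le1$, $M>0$ such that $$\mathcal E^\dagger(x)\le\mathcal R(x)-\mathcal R(x^\dagger)+M\|Ax-y\|^q\qquad\text{for all }x\in\mathrm{dom}(\mathcal R),$$ then $$\mathcal E^\dagger(x_{n_\delta})=O(\delta^q).$$ Consequently, if there is $\lambda^\dagger\in Y$ such that $A^*\lambda^\dagger\in\partial\mathcal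 R(x^\dagger)$, then $$D_{\mathcal R}^{A^*\lambda^\dagger}(x_{n_\delta},x^\dagger)=O(\delta)$$ and hence $\|x_{n_\delta}-x^\dagger\|=O(\delta^{1/2})$.
   Context: All vector spaces are real, and all norms are written $\|\cdot\|$. $X^*$ is the dual of $X$, $\langle\cdot,\cdot\rangle$ denotes both the duality pairing and the inner product of $Y$, and $A^*:Y\to X^*$ is the adjoint, $\langle A^*\lambda,x\rangle=\langle\lambda,Ax\rangle$. $\mathrm{dom}(\mathcal R)=\{x\in X:\mathcal R(x)<\infty\}$; $\mathcal R$ is proper if $\mathrm{dom}(\mathcal R)\neq\emptyset$. $\mathcal R$ is strongly convex if there is $\sigma>0$ with $\mathcal R(t\bar x+(1-t)x)+\sigma t(1-t)\|\bar x-x\|^2\le t\mathcal R(\bar x)+(1-t)\mathcal R(x)$ for all $\bar x,x\in\mathrm{dom}(\mathcal R)$, $t\in[0,1]$; the largest such $\sigma$ is the modulus of convexity. $\partial\mathcal R(x)=\{\xi\in X^*:\mathcal R(\bar x)\ge\mathcal R(x)+\langle\xi,\bar x-x\rangle\ \forall\bar x\in X\}$ is the subdifferential, and for $\xi\in\partial\mathcal R(x)$ the Bregman distance is $D_{\mathcal R}^{\xi}(\bar x,x)=\mathcal R(\bar x)-\mathcal R(x)-\langle\xi,\bar x-x\rangle$. Under the stated assumptions the constrained problem defining $x^\dagger$ and each minimization problem defining $x_n$ have a unique minimizer. The iterates depend on $y^\delta$ (and hence on $\delta$). $O(\cdot)$ is understood as $\delta\to0$, with constants independent of $\delta$ and of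 the particular $y^\delta$. *)

theory Defs
  imports "HOL-Analysis.Analysis"
begin

(* Functionals with values in (-\<infinity>,\<infinity>] are functions into ereal that avoid -\<infinity>;
   that restriction is part of proper_fun. *)

definition effective_dom :: "('a \<Rightarrow> ereal) \<Rightarrow> 'a set" where
  "effective_dom R = {x. R x < \<infinity>}"

definition proper_fun :: "('a \<Rightarrow> ereal) \<Rightarrow> bool" where
  "proper_fun R \<longleftrightarrow> (\<forall>x. R x \<noteq> -\<infinity>) \<and> effective_dom R \<noteq> {}"

definition lower_semicontinuous :: "('a::topological_space \<Rightarrow> ereal) \<Rightarrow> bool" where
  "lower_semicontinuous R \<longleftrightarrow> (\<forall>x. R x \<le> Liminf (at x) R)"

definition strongly_convex_with :: "('a::real_normed_vector \<Rightarrow> ereal) \<Rightarrow> real \<Rightarrow> bool" where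
  "strongly_convex_with R \<sigma> \<longleftrightarrow>
     0 < \<sigma> \<and>
     (\<forall>z\<in>effective_dom R. \<forall>x\<in>effective_dom R. \<forall>t\<in>{0..1}.
        R (t *\<^sub>R z + (1 - t) *\<^sub>R x) + ereal (\<sigma> * t * (1 - t) * (norm (z - x))\<^sup>2)
          \<le> ereal t * R z + ereal (1 - t) * R x)"

(* The modulus is the largest admissible constant. It does not exist when the effective domain
   is a single point, since then every positive constant is admissible. *)
definition modulus_of_convexity :: "('a::real_normed_vector \<Rightarrow> ereal) \<Rightarrow> real \<Rightarrow> bool" where
  "modulus_of_convexity R \<sigma> \<longleftrightarrow>
     strongly_convex_with R \<sigma> \<and> (\<forall>\<sigma>'. strongly_convex_with R \<sigma>' \<longrightarrow> \<sigma>' \<le> \<sigma>)"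

definition subdifferential :: "('a::real_normed_vector \<Rightarrow> ereal) \<Rightarrow> 'a \<Rightarrow> ('a \<Rightarrow>\<^sub>L real) set" where
  "subdifferential R x = {\<xi>. \<forall>z. R z \<ge> R x + ereal (blinfun_apply \<xi> (z - x))}"

definition bregman_dist ::
    "('a::real_normed_vector \<Rightarrow> ereal) \<Rightarrow> ('a \<Rightarrow>\<^sub>L real) \<Rightarrow> 'a \<Rightarrow> 'a \<Rightarrow> ereal" where
  "bregman_dist R \<xi> z x = R z - R x - ereal (blinfun_apply \<xi> (z - x))"

(* The adjoint of A as a map from Y into the dual of X, with Y identified with its own dual.
   The library constant adjoint is not applicable: it needs an inner product on X as well. *)
definition dual_adjoint ::
    "('a::real_normed_vector \<Rightarrow>\<^sub>L 'b::real_inner) \<Rightarrow> 'b \<Rightarrow> ('a \<Rightarrow>\<^sub>L real)" where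
  "dual_adjoint A l = blinfun_inner_left l o\<^sub>L A"

lemma dual_adjoint_apply: "blinfun_apply (dual_adjoint A l) x = l \<bullet> blinfun_apply A x"
  by (simp add: dual_adjoint_def inner_commute)

definition dual_gradient_iterates ::
    "('a::real_normed_vector \<Rightarrow>\<^sub>L 'b::real_inner) \<Rightarrow> ('a \<Rightarrow> ereal) \<Rightarrow> real \<Rightarrow> 'b \<Rightarrow>
     (nat \<Rightarrow> 'a) \<Rightarrow> (nat \<Rightarrow> 'b) \<Rightarrow> bool" where
  "dual_gradient_iterates A R \<gamma> yd x l \<longleftrightarrow>
     l 0 = 0 \<and>
     (\<forall>n. is_arg_min (\<lambda>u. R u - ereal (l n \<bullet> (blinfun_apply A u - yd))) (\<lambda>u. True) (x n)) \<and>
     (\<forall>n. l (Suc n) = l n - \<gamma> *\<^sub>R (blinfun_apply A (x n) - yd))"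

definition discrepancy_index ::
    "('a::real_normed_vector \<Rightarrow>\<^sub>L 'b::real_inner) \<Rightarrow> real \<Rightarrow> real \<Rightarrow> 'b \<Rightarrow> (nat \<Rightarrow> 'a) \<Rightarrow> nat \<Rightarrow> bool" where
  "discrepancy_index A \<tau> \<delta> yd x N \<longleftrightarrow>
     norm (blinfun_apply A (x N) - yd) \<le> \<tau> * \<delta> \<and>
     (\<forall>n<N. \<tau> * \<delta> < norm (blinfun_apply A (x n) - yd))"

(* \<Phi>(x_{n_\<delta>}) = O(g(\<delta>)) as \<delta> tends to 0 from the right, where the constant and the range of
   small \<delta> do not depend on the noisy datum yd. This is the library's bigO with the uniformity in
   yd made explicit and with extended real values of \<Phi> allowed. *)
definition stopped_iterate_bigO ::
    "('a::real_normed_vector \<Rightarrow>\<^sub>L 'b::real_inner) \<Rightarrow> ('a \<Rightarrow> ereal) \<Rightarrow> real \<Rightarrow> real \<Rightarrow> 'b \<Rightarrow>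
     ('a \<Rightarrow> ereal) \<Rightarrow> (real \<Rightarrow> real) \<Rightarrow> bool" where
  "stopped_iterate_bigO A R \<gamma> \<tau> y \<Phi> g \<longleftrightarrow>
     (\<exists>C>0. \<forall>\<^sub>F \<delta> in at_right 0. \<forall>yd x l N.
        norm (yd - y) \<le> \<delta> \<longrightarrow>
        dual_gradient_iterates A R \<gamma> yd x l \<longrightarrow>
        discrepancy_index A \<tau> \<delta> yd x N \<longrightarrow>
        \<bar>\<Phi> (x N)\<bar> \<le> ereal (C * \<bar>g \<delta>\<bar>))"

end

theory Submission
  imports Defs
begin

text \<open>The residual $r_n = Ax_n - y^\delta$ is the gradient at $\lambda_n$ of the convex dual
  functional, so the iteration is gradient descent on the dual problem. Everything rests on one
  estimate: up to the stopping index, $\|\lambda_n\| = O(\delta^{q-1})$ (\<open>multiplier_bound\<close>).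
  Given it, minimality of $x_N$, $N = n_\delta$, yields
  $\mathcal R(x_N) - \mathcal R(x^\dagger) \le \|\lambda_N\| \|Ax_N - y\|$, which is of order
  $\delta^{q-1}\cdot\delta$ by the discrepancy principle, and the variational source condition
  turns this into the rate for $\mathcal E^\dagger$ (\<open>stopped_primal_bound\<close>).

  To bound $\lambda_N$, evaluate the source condition at the mean $\bar x$ of
  $x_0, \dots, x_{N-1}$. Since $\lambda_N$ is $-\gamma$ times the sum of the residuals,
  $A\bar x - y^\delta = -\lambda_N/(\gamma N)$; and by convexity
  $N \mathcal R(\bar x) \le \sum_{k<N} \mathcal R(x_k)$, a sum that telescopes up to the dual values
  $d_k = \langle\lambda_k, r_k\rangle - \mathcal R(x_k)$. These satisfy the descent inequality
  $d_{k+1} + \gamma(1 - L\gamma/2)\|r_k\|^2 \le d_k$, where $\|r_k\| > \tau\delta$ before stopping,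
  and $d_N \ge -\mathcal R(x^\dagger) - \|\lambda_N\|\delta$. With $a = \|\lambda_N\|$,
  $b = \gamma N \delta$ and $c = \tau^2(1 - L\gamma)$ all this combines (\<open>multiplier_energy\<close>) to
  \[ a^2 - 2ab + cb^2 \le 2\gamma N M \left(\frac{a+b}{\gamma N}\right)^q. \]
  The hypothesis on $\tau$ and $\gamma$ says exactly that $c > 1$, so the quadratic form on the
  left dominates a multiple of $(a+b)^2$. Writing $s = (a+b)/(\gamma N)$, which is at least
  $\delta$, one gets $a + b = O(s^{q-1})$ and hence $O(\delta^{q-1})$, as $q \le 1$.

  The benchmark source condition $A^*\lambda^\dagger \in \partial\mathcal R(x^\dagger)$ is the case
  $q = 1$ in which $\mathcal E^\dagger$ is the Bregman distance, and this distance dominates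
  $\sigma\|x - x^\dagger\|^2$ (\<open>subgradient_quadratic_growth\<close>).\<close>

section \<open>Strongly convex functionals with values in the extended reals\<close>

lemma proper_fun_real:
  assumes "proper_fun R" "x \<in> effective_dom R"
  shows "R x = ereal (real_of_ereal (R x))"
  using assms by (cases "R x") (auto simp: proper_fun_def effective_dom_def)

lemma strongly_convex_real:
  assumes "proper_fun R" "strongly_convex_with R \<sigma>"
    and z: "z \<in> effective_dom R" and x: "x \<in> effective_dom R"
    and t: "0 \<le> t" "t \<le> 1"
  shows "t *\<^sub>R z + (1 - t) *\<^sub>R x \<in> effective_dom R"
    and "real_of_ereal (R (t *\<^sub>R z + (1 - t) *\<^sub>R x)) + \<sigma> * t * (1 - t) * (norm (z - x))\<^sup>2
      \<le> t * real_of_ereal (R z) + (1 - t) * real_of_ereal (R x)"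
proof -
  obtain a where a: "R z = ereal a"
    using proper_fun_real[OF assms(1) z] by blast
  obtain b where b: "R x = ereal b"
    using proper_fun_real[OF assms(1) x] by blast
  have le: "R (t *\<^sub>R z + (1 - t) *\<^sub>R x) + ereal (\<sigma> * t * (1 - t) * (norm (z - x))\<^sup>2)
      \<le> ereal t * R z + ereal (1 - t) * R x"
    using assms(2) z x t unfolding strongly_convex_with_def by auto
  have ninf: "R (t *\<^sub>R z + (1 - t) *\<^sub>R x) \<noteq> -\<infinity>"
    using assms(1) by (simp add: proper_fun_def)
  show "t *\<^sub>R z + (1 - t) *\<^sub>R x \<in> effective_dom R"
    using le a b unfolding effective_dom_def
    by (cases "R (t *\<^sub>R z + (1 - t) *\<^sub>R x)") auto
  show "real_of_ereal (R (t *\<^sub>R z + (1 - t) *\<^sub>R x)) + \<sigma> * t * (1 - t) * (norm (z - x))\<^sup>2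
      \<le> t * real_of_ereal (R z) + (1 - t) * real_of_ereal (R x)"
    using le ninf a b by (cases "R (t *\<^sub>R z + (1 - t) *\<^sub>R x)") auto
qed

lemma strongly_convex_imp_convex_on:
  assumes "proper_fun R" "strongly_convex_with R \<sigma>"
  shows "convex_on (effective_dom R) (\<lambda>x. real_of_ereal (R x))"
proof (rule convex_onI)
  have pos: "\<sigma> > 0"
    using assms(2) by (simp add: strongly_convex_with_def)
  show "real_of_ereal (R ((1 - t) *\<^sub>R z + t *\<^sub>R x))
      \<le> (1 - t) * real_of_ereal (R z) + t * real_of_ereal (R x)"
    if "0 < t" "t < 1" "z \<in> effective_dom R" "x \<in> effective_dom R" for t z x
  proof -
    have "0 \<le> \<sigma> * (1 - t) * t * (norm (z - x))\<^sup>2"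
      using pos that by simp
    then show ?thesis
      using strongly_convex_real(2)[OF assms that(3,4), of "1 - t"] that by simp
  qed
  show "convex (effective_dom R)"
    unfolding convex_alt
    using strongly_convex_real(1)[OF assms, of _ _ "1 - u" for u] by fastforce
qed

text \<open>Comparing $\mathcal R$ at $x$ and at the point $x + t(z-x)$ of the segment towards $z$
  and dividing by $t$ gives the inequality with $\sigma(1-t)$ in place of $\sigma$; then $t$ tends to $0$.\<close>

lemma subgradient_quadratic_growth:
  assumes "proper_fun R" "strongly_convex_with R \<sigma>"
    and sub: "\<xi> \<in> subdifferential R x"
    and x: "x \<in> effective_dom R" and z: "z \<in> effective_dom R"
  shows "real_of_ereal (R x) + blinfun_apply \<xi> (z - x) + \<sigma> * (norm (z - x))\<^sup>2
    \<le> real_of_ereal (R z)"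
proof -
  define f where "f = (\<lambda>u. real_of_ereal (R u))"
  have step: "f x + blinfun_apply \<xi> (z - x) + \<sigma> * (1 - t) * (norm (z - x))\<^sup>2 \<le> f z"
    if t: "0 < t" "t < 1" for t
  proof -
    let ?u = "t *\<^sub>R z + (1 - t) *\<^sub>R x"
    have u: "?u \<in> effective_dom R"
      and sc: "f ?u + \<sigma> * t * (1 - t) * (norm (z - x))\<^sup>2 \<le> t * f z + (1 - t) * f x"
      using strongly_convex_real[OF assms(1,2) z x, of t] t by (simp_all add: f_def)
    have "R x + ereal (blinfun_apply \<xi> (?u - x)) \<le> R ?u"
      using sub by (simp add: subdifferential_def)
    then have "f x + blinfun_apply \<xi> (?u - x) \<le> f ?u"
      unfolding f_def
      by (subst (asm) (1 2) proper_fun_real[OF assms(1)]) (use x u in auto)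
    moreover have "?u - x = t *\<^sub>R (z - x)"
      by (simp add: algebra_simps)
    then have "blinfun_apply \<xi> (?u - x) = t * blinfun_apply \<xi> (z - x)"
      by (simp add: blinfun.scaleR_right)
    ultimately have "t * (f x + blinfun_apply \<xi> (z - x) + \<sigma> * (1 - t) * (norm (z - x))\<^sup>2) \<le> t * f z"
      using sc by (simp add: algebra_simps)
    then show ?thesis
      using t by simp
  qed
  let ?h = "\<lambda>t. f x + blinfun_apply \<xi> (z - x) + \<sigma> * (1 - t) * (norm (z - x))\<^sup>2"
  have "(?h \<longlongrightarrow> ?h 0) (at_right 0)"
    by (intro tendsto_intros)
  moreover have "\<forall>\<^sub>F t in at_right (0::real). ?h t \<le> f z"
    unfolding eventually_at_right_field using step by (intro exI[of _ 1]) auto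
  ultimately have "?h 0 \<le> f z"
    by (rule tendsto_upperbound) simp
  then show ?thesis
    by (simp add: f_def)
qed

section \<open>A run of the dual gradient method\<close>

locale dual_gradient_run =
  fixes A :: "'a::real_normed_vector \<Rightarrow>\<^sub>L 'b::real_inner"
    and R :: "'a \<Rightarrow> ereal" and \<sigma> \<gamma> :: real and yd :: 'b
    and x :: "nat \<Rightarrow> 'a" and l :: "nat \<Rightarrow> 'b"
  assumes proper: "proper_fun R"
    and strongly_convex: "strongly_convex_with R \<sigma>"
    and step_pos: "\<gamma> > 0"
    and iterates: "dual_gradient_iterates A R \<gamma> yd x l"
begin

definition f :: "'a \<Rightarrow> real" where
  "f u = real_of_ereal (R u)"

definition residual :: "nat \<Rightarrow> 'b" where
  "residual n = blinfun_apply A (x n) - yd"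

text \<open>The value at $\lambda_n$ of the dual functional
  $\lambda \mapsto \sup_u \{\langle\lambda, Au - y^\delta\rangle - \mathcal R(u)\}$, whose supremum
  is attained at $x_n$ and whose gradient there is the residual.\<close>

definition dual_value :: "nat \<Rightarrow> real" where
  "dual_value n = l n \<bullet> residual n - f (x n)"

definition L :: real where
  "L = (norm A)\<^sup>2 / (2 * \<sigma>)"

lemma sigma_pos: "\<sigma> > 0"
  using strongly_convex by (simp add: strongly_convex_with_def)

lemma L_nonneg: "L \<ge> 0"
  using sigma_pos by (simp add: L_def)

lemma R_eq_f: "u \<in> effective_dom R \<Longrightarrow> R u = ereal (f u)"
  unfolding f_def by (rule proper_fun_real[OF proper])

lemma multiplier_0: "l 0 = 0"
  using iterates by (simp add: dual_gradient_iterates_def)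

lemma multiplier_Suc: "l (Suc n) = l n - \<gamma> *\<^sub>R residual n"
  using iterates by (simp add: dual_gradient_iterates_def residual_def)

lemma iterate_minimal:
  "R (x n) - ereal (l n \<bullet> residual n) \<le> R u - ereal (l n \<bullet> (blinfun_apply A u - yd))"
  using iterates unfolding dual_gradient_iterates_def residual_def is_arg_min_linorder by blast

lemma iterate_in_dom: "x n \<in> effective_dom R"
proof -
  obtain u where u: "u \<in> effective_dom R"
    using proper by (auto simp: proper_fun_def)
  show ?thesis
    using iterate_minimal[of n u] unfolding R_eq_f[OF u] effective_dom_def
    by (cases "R (x n)") auto
qed

lemma multiplier_subgradient: "dual_adjoint A (l n) \<in> subdifferential R (x n)"
  unfolding subdifferential_def
proof safe
  fix u
  show "R (x n) + ereal (blinfun_apply (dual_adjoint A (l n)) (u - x n)) \<le> R u"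
  proof (cases "u \<in> effective_dom R")
    case True
    show ?thesis
      using iterate_minimal[of n u] R_eq_f[OF True] R_eq_f[OF iterate_in_dom[of n]]
      by (simp add: dual_adjoint_apply residual_def blinfun.diff_right inner_diff_right)
  qed (simp add: effective_dom_def)
qed

lemma iterate_quadratic_growth:
  assumes "u \<in> effective_dom R"
  shows "f (x n) + l n \<bullet> (blinfun_apply A u - blinfun_apply A (x n)) + \<sigma> * (norm (u - x n))\<^sup>2 \<le> f u"
  using subgradient_quadratic_growth[OF proper strongly_convex multiplier_subgradient
      iterate_in_dom assms, of n]
  by (simp add: f_def dual_adjoint_apply blinfun.diff_right inner_diff_right)

text \<open>Quadratic growth at $x_n$, evaluated at $x_{n+1}$, makes the gradient of the dual functional
  $L$-Lipschitz in effect: the growth term $\sigma\|x_{n+1}-x_n\|^2$ absorbs by the inequality of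
  arithmetic and geometric means the change $A(x_{n+1}-x_n)$ of the residual.\<close>

lemma dual_value_descent:
  "dual_value (Suc n) + \<gamma> * (1 - L * \<gamma> / 2) * (norm (residual n))\<^sup>2 \<le> dual_value n"
proof -
  let ?w = "x (Suc n) - x n" and ?\<rho> = "residual n"
  have res: "residual (Suc n) = ?\<rho> + blinfun_apply A ?w"
    by (simp add: residual_def blinfun.diff_right)
  have growth: "f (x n) + l n \<bullet> blinfun_apply A ?w + \<sigma> * (norm ?w)\<^sup>2 \<le> f (x (Suc n))"
    using iterate_quadratic_growth[OF iterate_in_dom, of n "Suc n"] by (simp add: blinfun.diff_right)
  have "- (?\<rho> \<bullet> blinfun_apply A ?w) \<le> norm ?\<rho> * norm (blinfun_apply A ?w)"
    using norm_cauchy_schwarz[of "- ?\<rho>"] by simp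
  also have "\<dots> \<le> norm ?\<rho> * (norm A * norm ?w)"
    by (intro mult_left_mono norm_blinfun) auto
  finally have cs: "\<gamma> * (- (?\<rho> \<bullet> blinfun_apply A ?w)) \<le> \<gamma> * (norm ?\<rho> * (norm A * norm ?w))"
    using step_pos by (intro mult_left_mono) auto
  have "0 \<le> \<sigma> * (norm ?w - \<gamma> * norm ?\<rho> * norm A / (2 * \<sigma>))\<^sup>2"
    using sigma_pos by simp
  also have "\<dots> = \<sigma> * (norm ?w)\<^sup>2 - \<gamma> * (norm ?\<rho> * (norm A * norm ?w))
      + \<gamma> * (L * \<gamma> / 2) * (norm ?\<rho>)\<^sup>2"
    using sigma_pos by (simp add: L_def power2_eq_square field_simps)
  finally have amgm: "\<gamma> * (norm ?\<rho> * (norm A * norm ?w))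
      \<le> \<sigma> * (norm ?w)\<^sup>2 + \<gamma> * (L * \<gamma> / 2) * (norm ?\<rho>)\<^sup>2"
    by simp
  have "dual_value (Suc n) = l n \<bullet> ?\<rho> + l n \<bullet> blinfun_apply A ?w - \<gamma> * (norm ?\<rho>)\<^sup>2
      - \<gamma> * (?\<rho> \<bullet> blinfun_apply A ?w) - f (x (Suc n))"
    unfolding dual_value_def multiplier_Suc res
    by (simp add: inner_diff_left inner_add_right power2_norm_eq_inner algebra_simps)
  then show ?thesis
    using growth cs amgm by (simp add: dual_value_def algebra_simps)
qed

text \<open>The descent from $d_k$ to $d_{k+1}$ lies between $d_N$ and each of $d_0, \dots, d_k$ and
  is therefore counted $k+1$ times: this is where the factor $N^2$ in the final estimate comes from.\<close>

lemma sum_dual_values: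
  "real N * dual_value N
     + \<gamma> * (1 - L * \<gamma> / 2) * (\<Sum>k<N. (real k + 1) * (norm (residual k))\<^sup>2) \<le> (\<Sum>k<N. dual_value k)"
proof (induction N)
  case (Suc N)
  define \<kappa> where "\<kappa> = \<gamma> * (1 - L * \<gamma> / 2)"
  have "(real N + 1) * (dual_value (Suc N) + \<kappa> * (norm (residual N))\<^sup>2)
      \<le> (real N + 1) * dual_value N"
    unfolding \<kappa>_def using dual_value_descent by (intro mult_left_mono) auto
  then show ?case
    using Suc unfolding \<kappa>_def[symmetric] by (simp add: distrib_left distrib_right mult_ac)
qed simp

text \<open>The multiplier update turns $\langle\lambda_n, Ax_n - y^\delta\rangle$ into a difference of
  squares, so the sum of the primal values telescopes.\<close>

lemma sum_primal_values:
  "(\<Sum>k<N. f (x k)) = - (norm (l N))\<^sup>2 / (2 * \<gamma>) + \<gamma> / 2 * (\<Sum>k<N. (norm (residual k))\<^sup>2)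
     - (\<Sum>k<N. dual_value k)"
proof (induction N)
  case 0
  then show ?case by (simp add: multiplier_0)
next
  case (Suc N)
  have "(norm (l (Suc N)))\<^sup>2 = (norm (l N))\<^sup>2 - 2 * \<gamma> * (l N \<bullet> residual N) + \<gamma>\<^sup>2 * (norm (residual N))\<^sup>2"
    unfolding multiplier_Suc power2_norm_eq_inner
    by (simp add: inner_diff_left inner_diff_right inner_commute power2_eq_square)
  then have "- (norm (l (Suc N)))\<^sup>2 / (2 * \<gamma>)
      = - (norm (l N))\<^sup>2 / (2 * \<gamma>) + l N \<bullet> residual N - \<gamma> / 2 * (norm (residual N))\<^sup>2"
    using step_pos by (simp add: field_simps power2_eq_square)
  then show ?case
    using Suc by (simp add: dual_value_def algebra_simps)
qed

lemma multiplier_eq_sum: "l N = - \<gamma> *\<^sub>R (\<Sum>k<N. residual k)"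
  by (induction N) (simp_all add: multiplier_0 multiplier_Suc algebra_simps)

definition ergodic_mean :: "nat \<Rightarrow> 'a" where
  "ergodic_mean N = (\<Sum>k<N. (1 / real N) *\<^sub>R x k)"

text \<open>The averaging trades the dual variable for a primal one: up to the factor
  $-\gamma N$, the multiplier is the residual of a point at which a condition on $\mathcal R$ can be evaluated.\<close>

lemma ergodic_mean_residual:
  assumes "N > 0"
  shows "blinfun_apply A (ergodic_mean N) - yd = - (1 / (\<gamma> * real N)) *\<^sub>R l N"
proof -
  have "(\<Sum>k<N. residual k) = (\<Sum>k<N. blinfun_apply A (x k)) - real N *\<^sub>R yd"
    by (simp add: residual_def sum_subtractf sum_constant_scaleR)
  moreover have "blinfun_apply A (ergodic_mean N) = (1 / real N) *\<^sub>R (\<Sum>k<N. blinfun_apply A (x k))"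
    by (simp add: ergodic_mean_def blinfun.sum_right blinfun.scaleR_right scaleR_sum_right)
  ultimately show ?thesis
    using assms step_pos by (simp add: multiplier_eq_sum scaleR_diff_right)
qed

lemma ergodic_mean_in_dom:
  assumes "N > 0"
  shows "ergodic_mean N \<in> effective_dom R"
  unfolding ergodic_mean_def
  using assms iterate_in_dom
    convex_on_imp_convex[OF strongly_convex_imp_convex_on[OF proper strongly_convex]]
  by (intro convex_sum) auto

lemma f_ergodic_mean_le:
  assumes "N > 0"
  shows "real N * f (ergodic_mean N) \<le> (\<Sum>k<N. f (x k))"
proof -
  have "f (ergodic_mean N) \<le> (\<Sum>k<N. (1 / real N) * f (x k))"
    unfolding ergodic_mean_def f_def
    using assms iterate_in_dom strongly_convex_imp_convex_on[OF proper strongly_convex]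
    by (intro convex_on_sum[where C = "effective_dom R"]) auto
  then have "real N * f (ergodic_mean N) \<le> real N * (\<Sum>k<N. (1 / real N) * f (x k))"
    by (intro mult_left_mono) auto
  then show ?thesis
    using assms by (simp add: sum_distrib_left)
qed

lemma primal_value_le:
  assumes "u \<in> effective_dom R"
  shows "f (x n) - f u \<le> norm (l n) * norm (blinfun_apply A (x n) - blinfun_apply A u)"
proof -
  have "0 \<le> \<sigma> * (norm (u - x n))\<^sup>2"
    using sigma_pos by simp
  then have "f (x n) - f u \<le> l n \<bullet> (blinfun_apply A (x n) - blinfun_apply A u)"
    using iterate_quadratic_growth[OF assms, of n] by (simp add: inner_diff_right)
  also have "\<dots> \<le> norm (l n) * norm (blinfun_apply A (x n) - blinfun_apply A u)"
    by (rule norm_cauchy_schwarz)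
  finally show ?thesis .
qed

lemma dual_value_ge:
  assumes "u \<in> effective_dom R" "norm (yd - blinfun_apply A u) \<le> \<delta>"
  shows "- f u - norm (l n) * \<delta> \<le> dual_value n"
proof -
  have "0 \<le> \<sigma> * (norm (u - x n))\<^sup>2"
    using sigma_pos by simp
  then have "l n \<bullet> (blinfun_apply A u - yd) - f u \<le> dual_value n"
    using iterate_quadratic_growth[OF assms(1), of n]
    by (simp add: dual_value_def residual_def inner_diff_right)
  moreover have "l n \<bullet> (yd - blinfun_apply A u) \<le> norm (l n) * norm (yd - blinfun_apply A u)"
    by (rule norm_cauchy_schwarz)
  moreover have "\<dots> \<le> norm (l n) * \<delta>"
    using assms(2) by (intro mult_left_mono) auto
  ultimately show ?thesis
    by (simp add: inner_diff_right)
qed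

text \<open>The variational source condition bounds $N\mathcal R(u)$ by $N\mathcal R(\bar x)$ plus the
  right-hand side, for $\bar x$ the ergodic mean. Inserting the telescoped sum of primal values
  and the lower bound for the dual ones cancels $N\mathcal R(u)$ and leaves an inequality
  free of $\mathcal R$.\<close>

lemma multiplier_energy:
  assumes u: "u \<in> effective_dom R" "norm (yd - blinfun_apply A u) \<le> \<delta>"
    and vsc: "\<And>v. v \<in> effective_dom R \<Longrightarrow>
        f u \<le> f v + M * norm (blinfun_apply A v - blinfun_apply A u) powr q"
    and M: "M \<ge> 0" and q: "q > 0"
    and "N > 0" and "L * \<gamma> < 1" and "\<epsilon> \<ge> 0"
    and large: "\<And>k. k < N \<Longrightarrow> \<epsilon> \<le> norm (residual k)"
  shows "(norm (l N))\<^sup>2 / (2 * \<gamma>) - real N * norm (l N) * \<delta>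
      + \<gamma> * (1 - L * \<gamma>) * \<epsilon>\<^sup>2 * (real N)\<^sup>2 / 2
      \<le> real N * M * (norm (l N) / (\<gamma> * real N) + \<delta>) powr q"
proof -
  let ?m = "ergodic_mean N" and ?\<rho> = "\<lambda>k. (norm (residual k))\<^sup>2"
  have "blinfun_apply A ?m - blinfun_apply A u
      = (blinfun_apply A ?m - yd) + (yd - blinfun_apply A u)"
    by simp
  then have "norm (blinfun_apply A ?m - blinfun_apply A u)
      \<le> norm (blinfun_apply A ?m - yd) + norm (yd - blinfun_apply A u)"
    by (metis norm_triangle_ineq)
  also have "\<dots> \<le> norm (l N) / (\<gamma> * real N) + \<delta>"
    using u(2) \<open>N > 0\<close> step_pos by (simp add: ergodic_mean_residual)
  finally have "norm (blinfun_apply A ?m - blinfun_apply A u) powr q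
      \<le> (norm (l N) / (\<gamma> * real N) + \<delta>) powr q"
    using q by (intro powr_mono2) auto
  then have "M * norm (blinfun_apply A ?m - blinfun_apply A u) powr q
      \<le> M * (norm (l N) / (\<gamma> * real N) + \<delta>) powr q"
    using M by (intro mult_left_mono)
  then have "f u \<le> f ?m + M * (norm (l N) / (\<gamma> * real N) + \<delta>) powr q"
    using vsc[OF ergodic_mean_in_dom[OF \<open>N > 0\<close>]] by linarith
  then have "real N * f u \<le> real N * (f ?m + M * (norm (l N) / (\<gamma> * real N) + \<delta>) powr q)"
    by (intro mult_left_mono) auto
  then have lower: "real N * f u \<le> (\<Sum>k<N. f (x k)) + real N * M * (norm (l N) / (\<gamma> * real N) + \<delta>) powr q"
    using f_ergodic_mean_le[OF \<open>N > 0\<close>] by (simp add: distrib_left mult.assoc)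
  have "real N * (- f u - norm (l N) * \<delta>) \<le> real N * dual_value N"
    using dual_value_ge[OF u] by (intro mult_left_mono) auto
  then have dual: "real N * (- f u - norm (l N) * \<delta>)
      + \<gamma> * (1 - L * \<gamma> / 2) * (\<Sum>k<N. (real k + 1) * ?\<rho> k) \<le> (\<Sum>k<N. dual_value k)"
    using sum_dual_values[of N] by linarith
  have "(1 - L * \<gamma>) * \<epsilon>\<^sup>2 * (real k + 1 / 2) \<le> (1 - L * \<gamma> / 2) * ((real k + 1) * ?\<rho> k) - ?\<rho> k / 2"
    if "k < N" for k
  proof -
    have "\<epsilon>\<^sup>2 \<le> ?\<rho> k"
      using large[OF that] \<open>\<epsilon> \<ge> 0\<close> by (intro power_mono) auto
    then have "(1 - L * \<gamma>) * (real k + 1 / 2) * \<epsilon>\<^sup>2 \<le> (1 - L * \<gamma>) * (real k + 1 / 2) * ?\<rho> k"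
      using \<open>L * \<gamma> < 1\<close> by (intro mult_left_mono) auto
    also have "\<dots> \<le> ((1 - L * \<gamma> / 2) * (real k + 1) - 1 / 2) * ?\<rho> k"
      \<comment> \<open>the two factors differ by $k L\gamma/2$\<close>
    proof (rule mult_right_mono)
      have "0 \<le> L * \<gamma> * real k"
        using L_nonneg step_pos by simp
      then show "(1 - L * \<gamma>) * (real k + 1 / 2) \<le> (1 - L * \<gamma> / 2) * (real k + 1) - 1 / 2"
        by (simp add: algebra_simps)
    qed simp
    also have "\<dots> = (1 - L * \<gamma> / 2) * ((real k + 1) * ?\<rho> k) - ?\<rho> k / 2"
      by (simp add: left_diff_distrib[of _ _ "?\<rho> k"] mult.assoc)
    finally show ?thesis
      by (simp only: mult_ac)
  qed
  then have "(\<Sum>k<N. (1 - L * \<gamma>) * \<epsilon>\<^sup>2 * (real k + 1 / 2))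
      \<le> (\<Sum>k<N. (1 - L * \<gamma> / 2) * ((real k + 1) * ?\<rho> k) - ?\<rho> k / 2)"
    by (intro sum_mono) auto
  moreover have "(\<Sum>k<N. real k + 1 / 2) = (real N)\<^sup>2 / 2"
    by (induction N) (auto simp: power2_eq_square field_simps)
  ultimately have "(1 - L * \<gamma>) * \<epsilon>\<^sup>2 * ((real N)\<^sup>2 / 2)
      \<le> (1 - L * \<gamma> / 2) * (\<Sum>k<N. (real k + 1) * ?\<rho> k) - (\<Sum>k<N. ?\<rho> k) / 2"
    by (simp add: sum_subtractf flip: sum_distrib_left sum_divide_distrib)
  moreover have scale: "\<gamma> * (p * v - w / 2) = \<gamma> * p * v - \<gamma> / 2 * w" for p v w
    by (simp add: right_diff_distrib mult.assoc)
  ultimately have "\<gamma> * ((1 - L * \<gamma>) * \<epsilon>\<^sup>2 * ((real N)\<^sup>2 / 2))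
      \<le> \<gamma> * ((1 - L * \<gamma> / 2) * (\<Sum>k<N. (real k + 1) * ?\<rho> k) - (\<Sum>k<N. ?\<rho> k) / 2)"
    using step_pos by (intro mult_left_mono) auto
  then have "\<gamma> * (1 - L * \<gamma>) * \<epsilon>\<^sup>2 * (real N)\<^sup>2 / 2
      \<le> \<gamma> * (1 - L * \<gamma> / 2) * (\<Sum>k<N. (real k + 1) * ?\<rho> k) - \<gamma> / 2 * (\<Sum>k<N. ?\<rho> k)"
    unfolding scale by (simp add: mult.assoc)
  then show ?thesis
    using lower dual unfolding sum_primal_values by (simp add: right_diff_distrib mult.assoc)
qed

end

section \<open>Growth of the multipliers up to the stopping index\<close>

text \<open>The factor $(c-1)/(c+3)$ is the largest possible: the difference of the two sides is
  then $(2a - (c+1)b)^2/(c+3)$, which vanishes for $2a = (c+1)b$.\<close>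

lemma quadratic_form_coercive:
  fixes a b c :: real
  assumes "c > 1"
  shows "(c - 1) / (c + 3) * (a + b)\<^sup>2 \<le> a\<^sup>2 - 2 * a * b + c * b\<^sup>2"
proof -
  have "a\<^sup>2 - 2 * a * b + c * b\<^sup>2 - (c - 1) / (c + 3) * (a + b)\<^sup>2
      = (2 * a - (c + 1) * b)\<^sup>2 / (c + 3)"
    using assms by (simp add: field_simps power2_eq_square)
  moreover have "0 \<le> (2 * a - (c + 1) * b)\<^sup>2 / (c + 3)"
    using assms by simp
  ultimately show ?thesis by linarith
qed

context dual_gradient_run
begin

text \<open>The bound does not involve $N$: the energy inequality gives
  $\|\lambda_N\| + \gamma N\delta = O(s^{q-1})$ with
  $s = (\|\lambda_N\| + \gamma N\delta)/(\gamma N)$, and $s \ge \delta$ whatever $N$ is.\<close>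

lemma multiplier_bound:
  assumes u: "u \<in> effective_dom R" "norm (yd - blinfun_apply A u) \<le> \<delta>"
    and vsc: "\<And>v. v \<in> effective_dom R \<Longrightarrow>
        f u \<le> f v + M * norm (blinfun_apply A v - blinfun_apply A u) powr q"
    and M: "M \<ge> 0" and q: "0 < q" "q \<le> 1"
    and "L * \<gamma> < 1" and "\<tau> \<ge> 0" and "\<delta> > 0"
    and large: "\<And>k. k < N \<Longrightarrow> \<tau> * \<delta> \<le> norm (residual k)"
    and c: "c = \<tau>\<^sup>2 * (1 - L * \<gamma>)" "c > 1"
  shows "norm (l N) \<le> 2 * M * (c + 3) / (c - 1) * \<delta> powr (q - 1)"
proof (cases "N = 0")
  case True
  then show ?thesis
    using M c(2) by (simp add: multiplier_0)
next
  case False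
  define a b where "a = norm (l N)" and "b = \<gamma> * real N * \<delta>"
  define s where "s = (a + b) / (\<gamma> * real N)"
  have pos: "\<gamma> * real N > 0" "a \<ge> 0" "b > 0"
    using False step_pos \<open>\<delta> > 0\<close> by (simp_all add: a_def b_def)
  have s: "s = a / (\<gamma> * real N) + \<delta>"
    using False step_pos by (simp add: s_def b_def add_divide_distrib)
  then have "s \<ge> \<delta>"
    using pos by simp
  have "a\<^sup>2 / (2 * \<gamma>) - real N * a * \<delta> + \<gamma> * (1 - L * \<gamma>) * (\<tau> * \<delta>)\<^sup>2 * (real N)\<^sup>2 / 2
      \<le> real N * M * s powr q"
    unfolding s a_def using False assms by (intro multiplier_energy) auto
  also have "a\<^sup>2 / (2 * \<gamma>) - real N * a * \<delta> + \<gamma> * (1 - L * \<gamma>) * (\<tau> * \<delta>)\<^sup>2 * (real N)\<^sup>2 / 2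
      = (a\<^sup>2 - 2 * a * b + c * b\<^sup>2) / (2 * \<gamma>)"
    using step_pos by (simp add: b_def c(1) field_simps power2_eq_square)
  finally have "a\<^sup>2 - 2 * a * b + c * b\<^sup>2 \<le> 2 * M * (\<gamma> * real N * s powr q)"
    using step_pos by (simp add: field_simps)
  moreover have "\<gamma> * real N * s powr q = (a + b) * s powr (q - 1)"
    using pos \<open>s \<ge> \<delta>\<close> \<open>\<delta> > 0\<close> by (simp add: s_def powr_diff)
  ultimately have "(c - 1) / (c + 3) * (a + b)\<^sup>2 \<le> 2 * M * ((a + b) * s powr (q - 1))"
    using quadratic_form_coercive[OF c(2), of a b] by simp
  then have "(a + b) * ((c - 1) / (c + 3) * (a + b)) \<le> (a + b) * (2 * M * s powr (q - 1))"
    by (simp add: power2_eq_square mult_ac)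
  then have "(c - 1) / (c + 3) * (a + b) \<le> 2 * M * s powr (q - 1)"
    by (rule mult_left_le_imp_le) (use pos in simp)
  also have "\<dots> \<le> 2 * M * \<delta> powr (q - 1)"
    using M q \<open>s \<ge> \<delta>\<close> \<open>\<delta> > 0\<close> by (intro mult_left_mono powr_mono2') auto
  finally have "a + b \<le> 2 * M * (c + 3) / (c - 1) * \<delta> powr (q - 1)"
    using c(2) by (simp add: field_simps)
  then show ?thesis
    using pos by (simp add: a_def)
qed

text \<open>The left-hand side is the upper bound that a variational source condition gives for
  $\mathcal E^\dagger(x_N)$.\<close>

lemma stopped_primal_bound:
  assumes u: "u \<in> effective_dom R" "norm (yd - blinfun_apply A u) \<le> \<delta>"
    and vsc: "\<And>v. v \<in> effective_dom R \<Longrightarrow>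
        f u \<le> f v + M * norm (blinfun_apply A v - blinfun_apply A u) powr q"
    and M: "M \<ge> 0" and q: "0 < q" "q \<le> 1"
    and "L * \<gamma> < 1" and "\<tau> \<ge> 0" and "\<delta> > 0"
    and stop: "discrepancy_index A \<tau> \<delta> yd x N"
    and c: "c = \<tau>\<^sup>2 * (1 - L * \<gamma>)" "c > 1"
  shows "f (x N) - f u + M * norm (blinfun_apply A (x N) - blinfun_apply A u) powr q
    \<le> (2 * M * (c + 3) / (c - 1) * (\<tau> + 1) + M * (\<tau> + 1) powr q) * \<delta> powr q"
proof -
  let ?K = "2 * M * (c + 3) / (c - 1)" and ?d = "norm (blinfun_apply A (x N) - blinfun_apply A u)"
  have "?d \<le> norm (blinfun_apply A (x N) - yd) + norm (yd - blinfun_apply A u)"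
    using norm_triangle_ineq[of "blinfun_apply A (x N) - yd" "yd - blinfun_apply A u"] by simp
  also have "\<dots> \<le> (\<tau> + 1) * \<delta>"
    using stop u(2) by (simp add: discrepancy_index_def algebra_simps)
  finally have d: "?d \<le> (\<tau> + 1) * \<delta>" .
  have mult: "norm (l N) \<le> ?K * \<delta> powr (q - 1)"
    using assms by (intro multiplier_bound) (auto simp: discrepancy_index_def residual_def intro: less_imp_le)
  have "f (x N) - f u \<le> norm (l N) * ?d"
    by (rule primal_value_le[OF u(1)])
  also have "\<dots> \<le> (?K * \<delta> powr (q - 1)) * ((\<tau> + 1) * \<delta>)"
    using mult d M c(2) by (intro mult_mono) auto
  also have "\<dots> = ?K * (\<tau> + 1) * \<delta> powr q"
    using \<open>\<delta> > 0\<close> by (simp add: powr_diff)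
  finally have 1: "f (x N) - f u \<le> ?K * (\<tau> + 1) * \<delta> powr q" .
  have "?d powr q \<le> ((\<tau> + 1) * \<delta>) powr q"
    using d q by (intro powr_mono2) auto
  also have "\<dots> = (\<tau> + 1) powr q * \<delta> powr q"
    using \<open>\<tau> \<ge> 0\<close> \<open>\<delta> > 0\<close> by (simp add: powr_mult)
  finally have "M * ?d powr q \<le> M * ((\<tau> + 1) powr q * \<delta> powr q)"
    using M by (intro mult_left_mono)
  with 1 show ?thesis
    by (simp add: distrib_right mult.assoc)
qed

end

section \<open>Convergence rates\<close>

lemma variational_source_condition_rate:
  fixes A :: "'a::real_normed_vector \<Rightarrow>\<^sub>L 'b::real_inner"
  assumes proper: "proper_fun R" and sc: "strongly_convex_with R \<sigma>"
    and dom: "xdag \<in> effective_dom R" and y: "blinfun_apply A xdag = y"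
    and \<tau>: "\<tau> > 1" and "\<gamma> > 0"
    and step: "1 - 1 / \<tau>\<^sup>2 - (norm A)\<^sup>2 / (2 * \<sigma>) * \<gamma> > 0"
    and E: "\<And>v. v \<in> effective_dom R \<Longrightarrow> 0 \<le> E v"
    and M: "M > 0" and q: "0 < q" "q \<le> 1"
    and vsc: "\<And>v. v \<in> effective_dom R \<Longrightarrow>
        ereal (E v) \<le> R v - R xdag + ereal (M * norm (blinfun_apply A v - y) powr q)"
  shows "stopped_iterate_bigO A R \<gamma> \<tau> y (\<lambda>x. ereal (E x)) (\<lambda>\<delta>. \<delta> powr q)"
proof -
  define c where "c = \<tau>\<^sup>2 * (1 - (norm A)\<^sup>2 / (2 * \<sigma>) * \<gamma>)"
  define C where "C = 2 * M * (c + 3) / (c - 1) * (\<tau> + 1) + M * (\<tau> + 1) powr q"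
  have "\<tau>\<^sup>2 * (1 / \<tau>\<^sup>2) < c"
    unfolding c_def using step \<tau> by (intro mult_strict_left_mono) auto
  then have c: "c > 1"
    using \<tau> by simp
  have "(norm A)\<^sup>2 / (2 * \<sigma>) * \<gamma> < 1 - 1 / \<tau>\<^sup>2"
    using step by simp
  moreover have "0 < 1 / \<tau>\<^sup>2"
    using \<tau> by simp
  ultimately have small: "(norm A)\<^sup>2 / (2 * \<sigma>) * \<gamma> < 1"
    by linarith
  have "C > 0"
    unfolding C_def using M c \<tau> by (intro add_pos_pos mult_pos_pos divide_pos_pos) auto
  have vsc': "E v \<le> real_of_ereal (R v) - real_of_ereal (R xdag)
      + M * norm (blinfun_apply A v - y) powr q" if "v \<in> effective_dom R" for v
    using vsc[OF that] proper_fun_real[OF proper that] proper_fun_real[OF proper dom]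
    by (cases "R v"; cases "R xdag") auto
  have bound: "E (x N) \<le> C * \<delta> powr q"
    if "\<delta> > 0" "norm (yd - y) \<le> \<delta>" "dual_gradient_iterates A R \<gamma> yd x l"
      "discrepancy_index A \<tau> \<delta> yd x N" for \<delta> yd x l N
  proof -
    interpret dual_gradient_run A R \<sigma> \<gamma> yd x l
      by unfold_locales (fact proper sc \<open>\<gamma> > 0\<close> that(3))+
    have vscf: "E v \<le> f v - f xdag + M * norm (blinfun_apply A v - blinfun_apply A xdag) powr q"
      if "v \<in> effective_dom R" for v
      using vsc'[OF that] by (simp add: f_def y)
    have "f (x N) - f xdag + M * norm (blinfun_apply A (x N) - blinfun_apply A xdag) powr q
        \<le> C * \<delta> powr q"
      unfolding C_def
    proof (rule stopped_primal_bound)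
      show "f xdag \<le> f v + M * norm (blinfun_apply A v - blinfun_apply A xdag) powr q"
        if "v \<in> effective_dom R" for v
        using vscf[OF that] E[OF that] by linarith
    qed (use that dom M q small \<tau> c c_def y in \<open>auto simp: L_def\<close>)
    then show ?thesis
      using vscf[OF iterate_in_dom] by (rule order_trans[rotated])
  qed
  have "\<forall>\<^sub>F \<delta> in at_right 0. \<forall>yd x l N.
      norm (yd - y) \<le> \<delta> \<longrightarrow> dual_gradient_iterates A R \<gamma> yd x l \<longrightarrow>
      discrepancy_index A \<tau> \<delta> yd x N \<longrightarrow> \<bar>ereal (E (x N))\<bar> \<le> ereal (C * \<bar>\<delta> powr q\<bar>)"
  proof (rule eventually_mono[OF eventually_at_right_less], intro allI impI)
    fix \<delta> yd x l N
    assume *: "(0::real) < \<delta>" "norm (yd - y) \<le> \<delta>" "dual_gradient_iterates A R \<gamma> yd x l"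
      "discrepancy_index A \<tau> \<delta> yd x N"
    interpret dual_gradient_run A R \<sigma> \<gamma> yd x l
      by unfold_locales (fact proper sc \<open>\<gamma> > 0\<close> *(3))+
    show "\<bar>ereal (E (x N))\<bar> \<le> ereal (C * \<bar>\<delta> powr q\<bar>)"
      using bound[OF *] E[OF iterate_in_dom, of N] by simp
  qed
  then show ?thesis
    unfolding stopped_iterate_bigO_def using \<open>C > 0\<close> by blast
qed

text \<open>The pointwise comparison is restricted to the effective domain, which contains every
  iterate: only there are the Bregman distance finite and the coercivity estimate available.\<close>

lemma stopped_iterate_bigO_mono:
  fixes A :: "'a::real_normed_vector \<Rightarrow>\<^sub>L 'b::real_inner"
  assumes "proper_fun R" "strongly_convex_with R \<sigma>" "\<gamma> > 0"
    and \<Psi>: "stopped_iterate_bigO A R \<gamma> \<tau> y \<Psi> g"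
    and K: "\<And>C. C > 0 \<Longrightarrow> K C > 0"
    and imp: "\<And>C \<delta> v. C > 0 \<Longrightarrow> \<delta> > 0 \<Longrightarrow> v \<in> effective_dom R \<Longrightarrow>
       \<bar>\<Psi> v\<bar> \<le> ereal (C * \<bar>g \<delta>\<bar>) \<Longrightarrow> \<bar>\<Phi> v\<bar> \<le> ereal (K C * \<bar>h \<delta>\<bar>)"
  shows "stopped_iterate_bigO A R \<gamma> \<tau> y \<Phi> h"
proof -
  obtain C where C: "C > 0" and ev: "\<forall>\<^sub>F \<delta> in at_right 0. \<forall>yd x l N.
      norm (yd - y) \<le> \<delta> \<longrightarrow> dual_gradient_iterates A R \<gamma> yd x l \<longrightarrow>
      discrepancy_index A \<tau> \<delta> yd x N \<longrightarrow> \<bar>\<Psi> (x N)\<bar> \<le> ereal (C * \<bar>g \<delta>\<bar>)"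
    using \<Psi> unfolding stopped_iterate_bigO_def by blast
  have "\<forall>\<^sub>F \<delta> in at_right 0. \<forall>yd x l N.
      norm (yd - y) \<le> \<delta> \<longrightarrow> dual_gradient_iterates A R \<gamma> yd x l \<longrightarrow>
      discrepancy_index A \<tau> \<delta> yd x N \<longrightarrow> \<bar>\<Phi> (x N)\<bar> \<le> ereal (K C * \<bar>h \<delta>\<bar>)"
  proof (rule eventually_elim2[OF ev eventually_at_right_less], intro allI impI)
    fix \<delta> yd x l N
    assume *: "(0::real) < \<delta>" "norm (yd - y) \<le> \<delta>" "dual_gradient_iterates A R \<gamma> yd x l"
      "discrepancy_index A \<tau> \<delta> yd x N"
      and all: "\<forall>yd x l N. norm (yd - y) \<le> \<delta> \<longrightarrow> dual_gradient_iterates A R \<gamma> yd x l \<longrightarrow>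
        discrepancy_index A \<tau> \<delta> yd x N \<longrightarrow> \<bar>\<Psi> (x N)\<bar> \<le> ereal (C * \<bar>g \<delta>\<bar>)"
    interpret dual_gradient_run A R \<sigma> \<gamma> yd x l
      by unfold_locales (fact assms(1-3) *(3))+
    show "\<bar>\<Phi> (x N)\<bar> \<le> ereal (K C * \<bar>h \<delta>\<bar>)"
    proof (rule imp)
      show "\<bar>\<Psi> (x N)\<bar> \<le> ereal (C * \<bar>g \<delta>\<bar>)"
        using all *(2-4) by blast
    qed (fact C *(1) iterate_in_dom)+
  qed
  then show ?thesis
    unfolding stopped_iterate_bigO_def using K[OF C] by blast
qed

lemma bregman_dist_real:
  assumes "proper_fun R" "z \<in> effective_dom R" "u \<in> effective_dom R"
  shows "bregman_dist R \<xi> z u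
    = ereal (real_of_ereal (R z) - real_of_ereal (R u) - blinfun_apply \<xi> (z - u))"
  unfolding bregman_dist_def
  using proper_fun_real[OF assms(1,2)] proper_fun_real[OF assms(1,3)]
  by (cases "R z"; cases "R u") auto

theorem theorem3p7:
  fixes A :: "'a::banach \<Rightarrow>\<^sub>L 'b::{real_inner, complete_space}"
    and R :: "'a \<Rightarrow> ereal"
    and y :: 'b and xdag :: 'a
    and \<sigma> L \<tau> \<gamma> :: real
  assumes "proper_fun R"
    and "lower_semicontinuous R"
    and "modulus_of_convexity R \<sigma>"
    and "\<exists>x\<in>effective_dom R. blinfun_apply A x = y"
    and "is_arg_min R (\<lambda>x. blinfun_apply A x = y) xdag"
    and "L = (norm A)\<^sup>2 / (2 * \<sigma>)"
    and "\<tau> > 1"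
    and "\<gamma> > 0"
    and "1 - 1 / \<tau>\<^sup>2 - L * \<gamma> > 0"
  shows "(\<forall>(E :: 'a \<Rightarrow> real) (q :: real) (M :: real).
            (\<forall>x\<in>effective_dom R. 0 \<le> E x) \<and> E xdag = 0 \<and> 0 < q \<and> q \<le> 1 \<and> 0 < M \<and>
            (\<forall>x\<in>effective_dom R.
               ereal (E x) \<le> R x - R xdag + ereal (M * norm (blinfun_apply A x - y) powr q))
            \<longrightarrow> stopped_iterate_bigO A R \<gamma> \<tau> y (\<lambda>x. ereal (E x)) (\<lambda>\<delta>. \<delta> powr q))
       \<and> (\<forall>ldag :: 'b.
            dual_adjoint A ldag \<in> subdifferential R xdag
            \<longrightarrow> stopped_iterate_bigO A R \<gamma> \<tau> y
                  (\<lambda>x. bregman_dist R (dual_adjoint A ldag) x xdag) (\<lambda>\<delta>. \<delta>)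
              \<and> stopped_iterate_bigO A R \<gamma> \<tau> y
                  (\<lambda>x. ereal (norm (x - xdag))) (\<lambda>\<delta>. \<delta> powr (1 / 2)))"
proof -
  have sc: "strongly_convex_with R \<sigma>"
    using assms(3) by (simp add: modulus_of_convexity_def)
  then have \<sigma>: "\<sigma> > 0"
    by (simp add: strongly_convex_with_def)
  obtain u where u: "u \<in> effective_dom R" "blinfun_apply A u = y"
    using assms(4) by blast
  then have "R xdag \<le> R u"
    using assms(5) by (simp add: is_arg_min_linorder)
  then have dom: "xdag \<in> effective_dom R"
    using u(1) by (auto simp: effective_dom_def)
  have y: "blinfun_apply A xdag = y"
    using assms(5) by (simp add: is_arg_min_def)
  have step: "1 - 1 / \<tau>\<^sup>2 - (norm A)\<^sup>2 / (2 * \<sigma>) * \<gamma> > 0"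
    using assms(6,9) by simp
  note rate = variational_source_condition_rate[OF assms(1) sc dom y assms(7,8) step]
  show ?thesis
  proof (intro conjI allI impI)
    fix E :: "'a \<Rightarrow> real" and q M :: real
    assume "(\<forall>x\<in>effective_dom R. 0 \<le> E x) \<and> E xdag = 0 \<and> 0 < q \<and> q \<le> 1 \<and> 0 < M \<and>
      (\<forall>x\<in>effective_dom R.
        ereal (E x) \<le> R x - R xdag + ereal (M * norm (blinfun_apply A x - y) powr q))"
    then show "stopped_iterate_bigO A R \<gamma> \<tau> y (\<lambda>x. ereal (E x)) (\<lambda>\<delta>. \<delta> powr q)"
      by (intro rate[where M = M]) auto
  next
    fix ldag :: 'b
    let ?\<xi> = "dual_adjoint A ldag"
    assume sub: "?\<xi> \<in> subdifferential R xdag"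
    define E where "E v = real_of_ereal (R v) - real_of_ereal (R xdag) - blinfun_apply ?\<xi> (v - xdag)"
      for v
    have breg: "bregman_dist R ?\<xi> v xdag = ereal (E v)" if "v \<in> effective_dom R" for v
      unfolding E_def by (rule bregman_dist_real[OF assms(1) that dom])
    have coercive: "\<sigma> * (norm (v - xdag))\<^sup>2 \<le> E v" if "v \<in> effective_dom R" for v
      using subgradient_quadratic_growth[OF assms(1) sc sub dom that] by (simp add: E_def)
    have "stopped_iterate_bigO A R \<gamma> \<tau> y (\<lambda>x. ereal (E x)) (\<lambda>\<delta>. \<delta> powr 1)"
      \<comment> \<open>the added $1$ keeps $M$ positive when $\lambda^\dagger = 0$\<close>
    proof (rule rate[where M = "norm ldag + 1"])
      show "0 \<le> E v" if "v \<in> effective_dom R" for v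
        using coercive[OF that] \<sigma> by (smt (verit) mult_nonneg_nonneg zero_le_power2)
      show "ereal (E v) \<le> R v - R xdag + ereal ((norm ldag + 1) * norm (blinfun_apply A v - y) powr 1)"
        if v: "v \<in> effective_dom R" for v
      proof -
        have "- (ldag \<bullet> (blinfun_apply A v - y)) \<le> norm ldag * norm (blinfun_apply A v - y)"
          using norm_cauchy_schwarz[of "- ldag"] by simp
        also have "\<dots> \<le> (norm ldag + 1) * norm (blinfun_apply A v - y)"
          by (intro mult_right_mono) auto
        finally have "E v \<le> real_of_ereal (R v) - real_of_ereal (R xdag)
            + (norm ldag + 1) * norm (blinfun_apply A v - y) powr 1"
          by (simp add: E_def dual_adjoint_apply blinfun.diff_right inner_diff_right y)
        then show ?thesis
          using proper_fun_real[OF assms(1) v] proper_fun_real[OF assms(1) dom]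
          by (cases "R v"; cases "R xdag") auto
      qed
    qed (simp_all add: add_nonneg_pos)
    note E_rate = this
    show "stopped_iterate_bigO A R \<gamma> \<tau> y (\<lambda>x. bregman_dist R ?\<xi> x xdag) (\<lambda>\<delta>. \<delta>)"
      by (rule stopped_iterate_bigO_mono[OF assms(1) sc assms(8) E_rate, where K = "\<lambda>C. C"])
        (simp_all add: breg)
    show "stopped_iterate_bigO A R \<gamma> \<tau> y (\<lambda>x. ereal (norm (x - xdag))) (\<lambda>\<delta>. \<delta> powr (1 / 2))"
    proof (rule stopped_iterate_bigO_mono[OF assms(1) sc assms(8) E_rate,
          where K = "\<lambda>C. sqrt (C / \<sigma>)"])
      fix C \<delta> :: real and v
      assume *: "C > 0" "\<delta> > 0" "v \<in> effective_dom R"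
        "\<bar>ereal (E v)\<bar> \<le> ereal (C * \<bar>\<delta> powr 1\<bar>)"
      then have "\<sigma> * (norm (v - xdag))\<^sup>2 \<le> C * \<delta>"
        using coercive[OF *(3)] by simp
      then have "(norm (v - xdag))\<^sup>2 \<le> C / \<sigma> * \<delta>"
        using \<sigma> by (simp add: field_simps)
      then have "norm (v - xdag) \<le> sqrt (C / \<sigma> * \<delta>)"
        by (rule real_le_rsqrt)
      then have "norm (v - xdag) \<le> sqrt (C / \<sigma>) * sqrt \<delta>"
        by (simp only: real_sqrt_mult)
      then show "\<bar>ereal (norm (v - xdag))\<bar> \<le> ereal (sqrt (C / \<sigma>) * \<bar>\<delta> powr (1 / 2)\<bar>)"
        using *(2) by (simp add: powr_half_sqrt)
    qed (use \<sigma> in simp)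
  qed
qed

end
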